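(* Let $X$ be a compact metric space, $m\in C(X,\mathbb{R}^{d\times d}_{\mathrm{psd}})$ and $M(\xi):=\int_X m(x)\,\mathrm{d}\xi(x)$ for $\xi\in\Xi(X)$. Let $\Psi:\mathbb{R}^{d\times d}_{\mathrm{psd}}\to\mathbb{R}\cup\{\infty\}$ be convex and lower semicontinuous with $\Xi_{\mathrm{fin}}(X)\ne\emptyset$, and suppose that $\Psi|_{\operatorname{dom}\Psi}$ is continuously differentiable and that $\operatorname{dom}\Psi$ is directionally open w.r.t. $M(\Xi(X))$. Let $X^0$ be a finite subset of $X$ with $\Xi_{\mathrm{fin}}(X^0)\neq\emptyset$, and let $(\xi^k)_{k\in K}$ (with associated points $(x^k)_{k\in K}$) be generated by the strict algorithm without exchange or by the strict algorithm with exchange, with initial discretization $X^0$ and optimality tolerances $\varepsilon,\overline{\delta}_k,\underline{\delta}_k\in[0,\infty)$ such that $$\overline{\delta}_k\le \overline{c}/(k+1)^2\qquad\text{and}\qquad \underline{\delta}_k\le\underline{c}/(k+2)\qquad(k\in\mathbb{N}_0)$$ for some constants $\overline{c},\underline{c}\in[0,\infty)$. Suppose finally that $$\mathcal{M}:=\operatorname{conv}\big(\big\{(1-\alpha)M(\xi^k)+\alpha\, m(x^k):k\in K\text{ and }\alpha\in[0,2/3]\big\}\big)\subset\operatorname{dom}\Psi$$ and that $\Psi|_{\mathcal{M}}$ is $L$-smooth w.r.t. $|\cdot|$ for some $L\in[0,\infty)$. Then $$\Psi(M(\xi^k))-\Psi^*\le\frac{2}{k+2}\Big(\big(\Psi(M(\xi^1))-\Psi^*\big)+L\,\big(\operatorname{diam}(M(\Xi(X)))\big)^2+\overline{c}+\underline{c}\Big)$$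 for all $k\in K$ with $k\ge2$, where $\Psi^*:=\min_{\xi\in\Xi(X)}\Psi(M(\xi))$ and $\operatorname{diam}(M(\Xi(X))):=\sup\{|M-N|:M,N\in M(\Xi(X))\}$.
   Context: Let $d\in\mathbb{N}$; $\mathbb{R}^{d\times d}_{\mathrm{psd}}$ is the set of (symmetric) positive semidefinite real $d\times d$ matrices; $|M|:=\operatorname{tr}(M^\top M)^{1/2}$ is the Frobenius norm; $\operatorname{conv}$ denotes the convex hull. $\Xi(X)$ is the set of Borel probability measures (designs) on $X$; for a finite $X'\subset X$, $\Xi(X')$ is identified with the designs on $X$ supported in $X'$. $\operatorname{supp}\xi$ is the support of $\xi$. $\operatorname{dom}\Psi:=\{M:\Psi(M)<\infty\}$, and for $X'\subset X$, $\Xi_{\mathrm{fin}}(X'):=\{\xi\in\Xi(X'):\Psi(M(\xi))<\infty\}$. A real-valued function on an arbitrary subset $S$ of $\mathbb{R}^{d\times d}$ is called (continuously) differentiable iff it extends to a (continuously) Fréchet differentiable function $\tilde\Psi$ on an open set of $\mathbb{R}^{d\times d}$ containing $S$; one writes $D\Psi(M)E:=D\tilde\Psi(M)E$, which is independent of the extension whenever $M+tE\in S$ for all sufficiently small $t\ge0$. $\operatorname{dom}\Psi$ is directionally open w.r.t. $M(\Xi(X))$ iff for every $M\in\operatorname{dom}\Psi$ and $\eta\in\Xi(X)$ there is $t^*\in(0,1]$ with $M+t(M(\eta)-M)\in\operatorname{dom}\Psi$ for all $t\in[0,t^*]$. For a convex set $C$, a function $\Psi:C\to\mathbb{R}$ is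 $L$-smooth w.r.t. $|\cdot|$ iff it is differentiable in the sense that it extends to a Fréchet differentiable function on an open set of $\mathbb{R}^{d\times d}$ containing $C$, and $\Psi(N)-\Psi(M)-D\Psi(M)(N-M)\le\frac L2|N-M|^2$ for all $M,N\in C$. The sensitivity function is $\psi(M,x):=D\Psi(M)(m(x)-M)$ for $M\in\operatorname{dom}\Psi$, $x\in X$. A $\delta$-approximate solution of a minimization problem is a feasible point whose objective value is at most the infimum plus $\delta$. Strict algorithms. Input: finite $X^0\subset X$, tolerances $\varepsilon,\overline{\delta}_k,\underline{\delta}_k\in[0,\infty)$ ($k\in\mathbb{N}_0$). Start with $k=0$. Step 1: compute a $\overline{\delta}_k$-approximate solution $\xi^k\in\Xi(X^k)$ of $\min_{\xi\in\Xi(X^k)}\Psi(M(\xi))$. Step 2: compute a $\underline{\delta}_k$-approximate solution $x^k\in X$ of $\min_{x\in X}\psi(M(\xi^k),x)$. If $\psi(M(\xi^k),x^k)<-\varepsilon+\underline{\delta}_k$, set $X^{k+1}:=X^k\cup\{x^k\}$ (algorithm without exchange) or $X^{k+1}:=\operatorname{supp}\xi^k\cup\{x^k\}$ (algorithm with exchange) and return to Step 1 with $k+1$ in place of $k$; if $\psi(M(\xi^k),x^k)\ge-\varepsilon+\underline{\delta}_k$, terminate. $K$ is the set of iteration indices: $K=\{0,\dots,k^*\}$ if the algorithm terminates in iteration $k^*$, and $K=\mathbb{N}_0$ if it does not terminate. *)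

theory Defs
  imports "HOL-Analysis.Analysis" "HOL-Probability.Probability_Measure"
begin

(* The norm of the type real^'n^'n is the Frobenius norm. *)
lemma norm_eq_frobenius:
  fixes A :: "real^'n^'m"
  shows "norm A = sqrt (trace (transpose A ** A))"
proof -
  have "norm A = sqrt (A \<bullet> A)"
    by (simp add: norm_eq_sqrt_inner)
  also have "A \<bullet> A = (\<Sum>i\<in>UNIV. \<Sum>j\<in>UNIV. A$i$j * A$i$j)"
    by (simp add: inner_vec_def)
  also have "\<dots> = (\<Sum>j\<in>UNIV. \<Sum>i\<in>UNIV. A$i$j * A$i$j)"
    by (rule sum.swap)
  also have "\<dots> = trace (transpose A ** A)"
    by (simp add: trace_def matrix_matrix_mult_def transpose_def)
  finally show ?thesis .
qed

definition psd :: "(real^'n^'n) set" where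
  "psd = {A. transpose A = A \<and> (\<forall>v. 0 \<le> v \<bullet> (A *v v))}"

section \<open>Designs\<close>

definition designs :: "'a::topological_space set \<Rightarrow> 'a measure set" where
  "designs X = {\<xi>. prob_space \<xi> \<and> sets \<xi> = sets (restrict_space borel X)}"

(* For a design on X, the space is X, and the sets U \<inter> space \<xi> with U open are the
   relatively open subsets of X. *)
definition supp :: "'a::topological_space measure \<Rightarrow> 'a set" where
  "supp \<xi> = {x \<in> space \<xi>. \<forall>U. open U \<and> x \<in> U \<longrightarrow> 0 < measure \<xi> (U \<inter> space \<xi>)}"

(* The designs on X supported in X', for finite X' \<subseteq> X *)
definition designs_in :: "'a::topological_space set \<Rightarrow> 'a set \<Rightarrow> 'a measure set" where
  "designs_in X X' = {\<xi> \<in> designs X. supp \<xi> \<subseteq> X'}"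

definition info :: "('a \<Rightarrow> real^'n^'n) \<Rightarrow> 'a measure \<Rightarrow> real^'n^'n" where
  "info m \<xi> = (\<integral>x. m x \<partial>\<xi>)"

section \<open>Design criteria\<close>

(* A criterion psd \<rightarrow> \<real> \<union> {\<infinity>} is modelled by a total ereal-valued function of
   which only the values on psd matter. *)

definition criterion :: "(real^'n^'n \<Rightarrow> ereal) \<Rightarrow> bool" where
  "criterion \<Psi> \<longleftrightarrow> (\<forall>A\<in>psd. \<Psi> A \<noteq> -\<infinity>)"

(* In ereal, 0 * \<infinity> = 0, so the endpoints t = 0 and t = 1 are harmless. *)
definition criterion_convex :: "(real^'n^'n \<Rightarrow> ereal) \<Rightarrow> bool" where
  "criterion_convex \<Psi> \<longleftrightarrow>
     (\<forall>A\<in>psd. \<forall>B\<in>psd. \<forall>t\<in>{0..1}.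
        \<Psi> ((1 - t) *\<^sub>R A + t *\<^sub>R B) \<le> ereal (1 - t) * \<Psi> A + ereal t * \<Psi> B)"

definition criterion_lsc :: "(real^'n^'n \<Rightarrow> ereal) \<Rightarrow> bool" where
  "criterion_lsc \<Psi> \<longleftrightarrow> (\<forall>A\<in>psd. \<Psi> A \<le> Liminf (at A within psd) \<Psi>)"

definition eff_dom :: "(real^'n^'n \<Rightarrow> ereal) \<Rightarrow> (real^'n^'n) set" where
  "eff_dom \<Psi> = {A \<in> psd. \<Psi> A < \<infinity>}"

definition finite_designs ::
    "(real^'n^'n \<Rightarrow> ereal) \<Rightarrow> ('a \<Rightarrow> real^'n^'n) \<Rightarrow> 'a::topological_space measure set \<Rightarrow> 'a measure set" where
  "finite_designs \<Psi> m \<Xi> = {\<xi> \<in> \<Xi>. \<Psi> (info m \<xi>) < \<infinity>}"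

definition opt_value ::
    "(real^'n^'n \<Rightarrow> ereal) \<Rightarrow> ('a \<Rightarrow> real^'n^'n) \<Rightarrow> 'a::topological_space set \<Rightarrow> ereal" where
  "opt_value \<Psi> m X = (INF \<xi>\<in>designs X. \<Psi> (info m \<xi>))"

definition directionally_open ::
    "(real^'n^'n) set \<Rightarrow> (real^'n^'n) set \<Rightarrow> bool" where
  "directionally_open S T \<longleftrightarrow>
     (\<forall>A\<in>S. \<forall>B\<in>T. \<exists>t'. 0 < t' \<and> t' \<le> 1 \<and> (\<forall>t\<in>{0..t'}. A + t *\<^sub>R (B - A) \<in> S))"

section \<open>Differentiability on arbitrary sets\<close>

definition diff_extension ::
    "('v::real_normed_vector) set \<Rightarrow> ('v \<Rightarrow> real) \<Rightarrow> 'v set \<Rightarrow> ('v \<Rightarrow> real) \<Rightarrow> bool" where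
  "diff_extension S f U g \<longleftrightarrow>
     open U \<and> S \<subseteq> U \<and> (\<forall>A\<in>U. g differentiable (at A)) \<and> (\<forall>A\<in>S. g A = f A)"

definition set_differentiable ::
    "('v::real_normed_vector) set \<Rightarrow> ('v \<Rightarrow> real) \<Rightarrow> bool" where
  "set_differentiable S f \<longleftrightarrow> (\<exists>U g. diff_extension S f U g)"

definition set_continuously_differentiable ::
    "('v::real_normed_vector) set \<Rightarrow> ('v \<Rightarrow> real) \<Rightarrow> bool" where
  "set_continuously_differentiable S f \<longleftrightarrow>
     (\<exists>U g. \<exists>g' :: 'v \<Rightarrow> 'v \<Rightarrow>\<^sub>L real. diff_extension S f U g \<and>
        (\<forall>A\<in>U. (g has_derivative blinfun_apply (g' A)) (at A)) \<and> continuous_on U g')"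

(* The derivative of f at A in the direction E, computed from a differentiable extension.
   It does not depend on the extension, so that THE is meaningful, if A + t E lies in S for
   all sufficiently small t \<ge> 0; it is only used in this case. *)
definition set_deriv ::
    "('v::real_normed_vector) set \<Rightarrow> ('v \<Rightarrow> real) \<Rightarrow> 'v \<Rightarrow> 'v \<Rightarrow> real" where
  "set_deriv S f A E = (THE d. \<exists>U g. diff_extension S f U g \<and> d = frechet_derivative g (at A) E)"

definition L_smooth ::
    "real \<Rightarrow> ('v::real_normed_vector) set \<Rightarrow> ('v \<Rightarrow> real) \<Rightarrow> bool" where
  "L_smooth L C f \<longleftrightarrow>
     convex C \<and> set_differentiable C f \<and>
     (\<forall>A\<in>C. \<forall>B\<in>C. f B - f A - set_deriv C f A (B - A) \<le> L / 2 * (norm (B - A))\<^sup>2)"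

definition sensitivity ::
    "(real^'n^'n \<Rightarrow> ereal) \<Rightarrow> ('a \<Rightarrow> real^'n^'n) \<Rightarrow> real^'n^'n \<Rightarrow> 'a \<Rightarrow> real" where
  "sensitivity \<Psi> m A x = set_deriv (eff_dom \<Psi>) (\<lambda>B. real_of_ereal (\<Psi> B)) A (m x - A)"

section \<open>Strict algorithms\<close>

definition approx_solution :: "real \<Rightarrow> 'b set \<Rightarrow> ('b \<Rightarrow> ereal) \<Rightarrow> 'b \<Rightarrow> bool" where
  "approx_solution \<delta> F f z \<longleftrightarrow> z \<in> F \<and> f z \<le> (INF y\<in>F. f y) + ereal \<delta>"

(* The sequences below are indexed by all natural numbers. Only the indices of the iterations
   that are performed matter, that is, those not preceded by a terminating iteration; the
   values at all other indices are unconstrained. *)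
definition iterations ::
    "(real^'n^'n \<Rightarrow> ereal) \<Rightarrow> ('a \<Rightarrow> real^'n^'n) \<Rightarrow> real \<Rightarrow> (nat \<Rightarrow> real) \<Rightarrow>
     (nat \<Rightarrow> 'a measure) \<Rightarrow> (nat \<Rightarrow> 'a) \<Rightarrow> nat set" where
  "iterations \<Psi> m \<epsilon> \<delta>u \<xi> x =
     {k. \<forall>j<k. sensitivity \<Psi> m (info m (\<xi> j)) (x j) < - \<epsilon> + \<delta>u j}"

(* \<delta>o and \<delta>u are the tolerances in the first and in the second step, Xs the sequence of
   discretizations. The points kept from the discretization X' with computed design \<xi>' are
   given by keep X' \<xi>'; they distinguish the two variants of the algorithm. *)
definition strict_algorithm ::
    "('a set \<Rightarrow> 'a measure \<Rightarrow> 'a set) \<Rightarrow> (real^'n^'n \<Rightarrow> ereal) \<Rightarrow> ('a \<Rightarrow> real^'n^'n) \<Rightarrow>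
     'a::topological_space set \<Rightarrow> 'a set \<Rightarrow> real \<Rightarrow> (nat \<Rightarrow> real) \<Rightarrow> (nat \<Rightarrow> real) \<Rightarrow>
     (nat \<Rightarrow> 'a set) \<Rightarrow> (nat \<Rightarrow> 'a measure) \<Rightarrow> (nat \<Rightarrow> 'a) \<Rightarrow> bool" where
  "strict_algorithm keep \<Psi> m X X0 \<epsilon> \<delta>o \<delta>u Xs \<xi> x \<longleftrightarrow>
     Xs 0 = X0 \<and>
     (\<forall>k\<in>iterations \<Psi> m \<epsilon> \<delta>u \<xi> x.
        approx_solution (\<delta>o k) (designs_in X (Xs k)) (\<lambda>\<eta>. \<Psi> (info m \<eta>)) (\<xi> k) \<and>
        approx_solution (\<delta>u k) X (\<lambda>y. ereal (sensitivity \<Psi> m (info m (\<xi> k)) y)) (x k) \<and>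
        (sensitivity \<Psi> m (info m (\<xi> k)) (x k) < - \<epsilon> + \<delta>u k \<longrightarrow>
           Xs (Suc k) = keep (Xs k) (\<xi> k) \<union> {x k}))"

abbreviation "strict_algorithm_without_exchange \<equiv> strict_algorithm (\<lambda>X' \<xi>'. X')"

abbreviation "strict_algorithm_with_exchange \<equiv> strict_algorithm (\<lambda>X' \<xi>'. supp \<xi>')"

end

theory Submission
  imports Defs
begin

text \<open>
  The algorithm is compared with the Frank-Wolfe method. Let \<open>r k\<close> be the gap between the value
  at the \<open>k\<close>-th iterate and the optimal value. The discretization in iteration \<open>k + 1\<close> contains the
  support of the current design and the new point \<open>x k\<close>, so the new value is, up to the
  tolerance, at most the value at \<open>(1 - t) M + t m (x k)\<close>, where \<open>M\<close> is the current information
  matrix and \<open>t\<close> is an arbitrary step size (\<open>strict_algorithm_properties\<close>). That is at least as good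
  as a Frank-Wolfe step. By smoothness such a step increases the value by at most
  \<open>t\<close> times the sensitivity at \<open>x k\<close> plus \<open>L t\<^sup>2 / 2\<close> times the squared diameter
  (\<open>smooth_step\<close>), and by convexity the sensitivity at \<open>x k\<close> is at most \<open>- r k\<close> plus the tolerance
  (\<open>sensitivity_approx_solution\<close>). The step size \<open>t = 2 / (k + 2)\<close>, admissible from \<open>k = 1\<close> on because
  it must not exceed \<open>2/3\<close>, turns this into a recursion for \<open>r\<close> whose solution has the asserted
  rate (\<open>recursion_rate\<close>).

  Designs enter only through their information matrices: the matrices of all designs form the
  convex hull of \<open>m ` X\<close>, and those of the designs on a finite set \<open>X'\<close> form the convex hull of
  \<open>m ` X'\<close> (\<open>info_designs\<close>, \<open>info_designs_in\<close>). So mixtures of designs reduce to convex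
  combinations of matrices, and one obtains compactness, hence with lower semicontinuity the existence of
  an optimal design (\<open>optimal_design_exists\<close>).
\<close>

section \<open>Integrals and convex sets\<close>

text \<open>If the integral were outside, a hyperplane would separate it strictly from the set, and
  integrating the separating functional would give a contradiction.\<close>

lemma (in prob_space) integral_in_closed_convex:
  fixes f :: "'a \<Rightarrow> 'b::euclidean_space"
  assumes f: "integrable M f" and C: "closed C" "convex C" and AE: "AE y in M. f y \<in> C"
  shows "(\<integral>y. f y \<partial>M) \<in> C"
proof (rule ccontr)
  assume "(\<integral>y. f y \<partial>M) \<notin> C"
  then obtain a b where ab: "a \<bullet> (\<integral>y. f y \<partial>M) < b" "\<And>z. z \<in> C \<Longrightarrow> b < a \<bullet> z"
    using separating_hyperplane_closed_point[OF C(2,1)] by metis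
  have "AE y in M. b \<le> a \<bullet> f y"
    using AE by eventually_elim (use ab(2) less_imp_le in blast)
  then have "(\<integral>y. b \<partial>M) \<le> (\<integral>y. a \<bullet> f y \<partial>M)"
    using f by (intro integral_mono_AE) auto
  also have "\<dots> = a \<bullet> (\<integral>y. f y \<partial>M)"
    using f by simp
  finally show False
    using ab(1) by (simp add: prob_space)
qed

lemma convex_hull_image_finite:
  fixes f :: "'a \<Rightarrow> 'b::real_vector"
  assumes "finite A" "z \<in> convex hull (f ` A)"
  shows "\<exists>u. (\<forall>y\<in>A. 0 \<le> u y) \<and> sum u A = 1 \<and> (\<Sum>y\<in>A. u y *\<^sub>R f y) = z"
proof -
  obtain v where v: "\<forall>w\<in>f ` A. 0 \<le> v w" "sum v (f ` A) = 1" "(\<Sum>w\<in>f ` A. v w *\<^sub>R w) = z"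
    using assms convex_hull_finite[of "f ` A"] by auto
  \<comment> \<open>The weight of a point of the image is given to one selected preimage.\<close>
  define s where "s = inv_into A f"
  have s: "s ` f ` A \<subseteq> A" "inj_on s (f ` A)" "\<And>w. w \<in> f ` A \<Longrightarrow> f (s w) = w"
    unfolding s_def by (auto simp: inv_into_into f_inv_into_f inj_on_inv_into)
  define u where "u y = (if y \<in> s ` f ` A then v (f y) else 0)" for y
  have "sum u A = sum u (s ` f ` A)"
    using assms(1) s(1) by (intro sum.mono_neutral_right) (auto simp: u_def)
  also have "\<dots> = sum v (f ` A)"
    using s by (simp add: sum.reindex u_def)
  finally have 1: "sum u A = 1" using v(2) by simp
  have "(\<Sum>y\<in>A. u y *\<^sub>R f y) = (\<Sum>y\<in>s ` f ` A. u y *\<^sub>R f y)"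
    using assms(1) s(1) by (intro sum.mono_neutral_right) (auto simp: u_def)
  also have "\<dots> = (\<Sum>w\<in>f ` A. v w *\<^sub>R w)"
    using s by (simp add: sum.reindex u_def)
  finally show ?thesis
    using 1 v s(1) by (intro exI[of _ u]) (auto simp: u_def)
qed

section \<open>Information matrices of designs\<close>

lemma space_design: "\<xi> \<in> designs X \<Longrightarrow> space \<xi> = X"
  using sets_eq_imp_space_eq[of \<xi> "restrict_space borel X"]
  by (auto simp: designs_def space_restrict_space)

lemma integrable_design:
  fixes m :: "'a::topological_space \<Rightarrow> 'b::euclidean_space"
  assumes "compact X" "continuous_on X m" "\<xi> \<in> designs X"
  shows "integrable \<xi> m"
proof -
  interpret prob_space \<xi> using assms(3) by (simp add: designs_def)
  have "m \<in> borel_measurable (restrict_space borel X)"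
    using assms(2) by (rule borel_measurable_continuous_on_restrict)
  then have meas: "m \<in> borel_measurable \<xi>"
    using assms(3) by (subst measurable_cong_sets[of \<xi> "restrict_space borel X" borel borel])
      (auto simp: designs_def)
  obtain B where "\<And>y. y \<in> X \<Longrightarrow> norm (m y) \<le> B"
    using compact_imp_bounded[OF compact_continuous_image[OF assms(2,1)]]
    by (auto simp: bounded_iff)
  then show ?thesis
    using meas space_design[OF assms(3)] by (intro integrable_const_bound[of _ B]) auto
qed

text \<open>A point outside the support has a null neighbourhood. The points of the compact set at
  distance at least \<open>1/(n+1)\<close> from the finite set are covered by finitely many of these, and
  the complement of the finite set is the union of such pieces.\<close>

lemma AE_design_in_finite:
  fixes X :: "'a::metric_space set"
  assumes "compact X" "\<xi> \<in> designs_in X X'" "finite X'"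
  shows "AE y in \<xi>. y \<in> X'"
proof -
  have \<xi>: "\<xi> \<in> designs X" "supp \<xi> \<subseteq> X'" using assms(2) by (auto simp: designs_in_def)
  interpret prob_space \<xi> using \<xi>(1) by (simp add: designs_def)
  have sp: "space \<xi> = X" by (rule space_design[OF \<xi>(1)])
  have sets: "U \<inter> X \<in> sets \<xi>" if "open U" for U
    using \<xi>(1) that by (auto simp: designs_def sets_restrict_space)
  define C where "C n = X - (\<Union>y\<in>X'. ball y (1 / (real n + 1)))" for n :: nat
  have "AE y in \<xi>. y \<notin> C n" for n
  proof -
    have "compact (C n)"
      unfolding C_def using assms(1) by (intro compact_diff) auto
    have "\<exists>U. open U \<and> z \<in> U \<and> measure \<xi> (U \<inter> X) = 0" if "z \<in> C n" for z
    proof -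
      have "z \<in> X" "z \<notin> X'" using that by (force simp: C_def)+
      then have "z \<notin> supp \<xi>" using \<xi>(2) by auto
      then show ?thesis using \<open>z \<in> X\<close>
        by (auto simp: supp_def sp) (metis measure_nonneg order_le_less)
    qed
    then obtain U where U: "\<And>z. z \<in> C n \<Longrightarrow> open (U z) \<and> z \<in> U z \<and> measure \<xi> (U z \<inter> X) = 0"
      by metis
    have "C n \<subseteq> (\<Union>z\<in>C n. U z)" using U by auto
    then obtain F where F: "F \<subseteq> C n" "finite F" "C n \<subseteq> (\<Union>z\<in>F. U z)"
      using compactE_image[OF \<open>compact (C n)\<close>, of "C n" U] U by metis
    have "(\<Union>z\<in>F. U z \<inter> X) \<in> null_sets \<xi>"
      using F(1,2) U sets by (intro null_sets_UN' countable_finite)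
        (auto simp: null_sets_def emeasure_eq_measure subset_iff)
    then show ?thesis
      by (rule AE_I') (use F(3) in \<open>auto simp: C_def\<close>)
  qed
  then have "AE y in \<xi>. \<forall>n. y \<notin> C n" by (simp add: AE_all_countable)
  then show ?thesis
  proof (rule AE_mp, intro AE_I2 impI)
    fix y assume y: "y \<in> space \<xi>" "\<forall>n. y \<notin> C n"
    show "y \<in> X'"
    proof (rule ccontr)
      assume "y \<notin> X'"
      moreover have "open (- X')" using assms(3) by (simp add: finite_imp_closed open_Compl)
      ultimately obtain e where e: "e > 0" "ball y e \<subseteq> - X'"
        by (metis ComplI open_contains_ball)
      obtain n :: nat where "1 / (real n + 1) < e"
        using reals_Archimedean[OF e(1)] by (auto simp: inverse_eq_divide add.commute)
      then have "y \<in> C n" using e(2) y(1) by (force simp: C_def sp dist_commute)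
      then show False using y(2) by blast
    qed
  qed
qed

text \<open>A convex combination of the matrices \<open>m y\<close> is the information matrix of the design that
  puts the weights on the points \<open>y\<close>.\<close>

lemma convex_hull_subset_info:
  fixes X :: "'a::metric_space set" and m :: "'a \<Rightarrow> real^'n^'n"
  assumes "compact X" "continuous_on X m" "finite X'" "X' \<subseteq> X"
    and z: "z \<in> convex hull (m ` X')"
  shows "\<exists>\<eta>\<in>designs_in X X'. info m \<eta> = z"
proof -
  obtain u where u: "\<And>y. y \<in> X' \<Longrightarrow> 0 \<le> u y" "sum u X' = 1" "(\<Sum>y\<in>X'. u y *\<^sub>R m y) = z"
    using convex_hull_image_finite[OF assms(3) z] by auto
  define P where "P = point_measure X' (\<lambda>y. ennreal (u y))"
  define \<eta> where "\<eta> = distr P (restrict_space borel X) (\<lambda>y. y)"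
  have em: "emeasure P A = ennreal (sum u A)" if "A \<subseteq> X'" for A
    using that assms(3) u(1) unfolding P_def
    by (subst emeasure_point_measure_finite) (auto intro!: sum_ennreal)
  have meas: "(\<lambda>y. y) \<in> measurable P (restrict_space borel X)"
    using assms(4) by (auto simp: P_def measurable_point_measure_eq1 space_restrict_space)
  have spP: "space P = X'" by (simp add: P_def space_point_measure)
  interpret P: prob_space P
    by (rule prob_spaceI) (simp add: spP em u(2))
  have "prob_space \<eta>" unfolding \<eta>_def using meas by (rule P.prob_space_distr)
  then have des: "\<eta> \<in> designs X" by (simp add: designs_def \<eta>_def)
  have "supp \<eta> \<subseteq> X'"
  proof
    fix y assume y: "y \<in> supp \<eta>"
    show "y \<in> X'"
    proof (rule ccontr)
      assume "y \<notin> X'"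
      have op: "open (- X')" using assms(3) by (simp add: finite_imp_closed open_Compl)
      have "emeasure \<eta> (- X' \<inter> X) = emeasure P ((- X' \<inter> X) \<inter> X')"
        unfolding \<eta>_def using meas op
        by (subst emeasure_distr) (auto simp: sets_restrict_space spP)
      also have "(- X' \<inter> X) \<inter> X' = {}" by auto
      finally have "measure \<eta> (- X' \<inter> X) = 0" by (simp add: measure_def)
      then show False
        using y op \<open>y \<notin> X'\<close> space_design[OF des] by (auto simp: supp_def)
    qed
  qed
  moreover have "info m \<eta> = (\<integral>y. m y \<partial>P)"
    unfolding info_def \<eta>_def
    using meas borel_measurable_continuous_on_restrict[OF assms(2)] by (rule integral_distr)
  moreover have "(\<integral>y. m y \<partial>P) = (\<Sum>y\<in>X'. u y *\<^sub>R m y)"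
    unfolding P_def using assms(3) u(1) by (rule lebesgue_integral_point_measure_finite)
  ultimately show ?thesis using des u(3) by (auto simp: designs_in_def)
qed

lemma info_designs_in:
  fixes X :: "'a::metric_space set" and m :: "'a \<Rightarrow> real^'n^'n"
  assumes "compact X" "continuous_on X m" "finite X'" "X' \<subseteq> X"
  shows "info m ` designs_in X X' = convex hull (m ` X')"
proof (intro equalityI subsetI)
  fix z assume "z \<in> info m ` designs_in X X'"
  then obtain \<xi> where \<xi>: "\<xi> \<in> designs_in X X'" "z = info m \<xi>" by auto
  then interpret prob_space \<xi> by (simp add: designs_in_def designs_def)
  have "AE y in \<xi>. m y \<in> convex hull (m ` X')"
    using AE_design_in_finite[OF assms(1) \<xi>(1) assms(3)]
    by eventually_elim (simp add: hull_inc)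
  then show "z \<in> convex hull (m ` X')"
    unfolding \<xi>(2) info_def using \<xi>(1) assms
    by (intro integral_in_closed_convex integrable_design[OF assms(1,2)])
       (auto simp: designs_in_def finite_imp_compact_convex_hull compact_imp_closed)
next
  fix z assume "z \<in> convex hull (m ` X')"
  from convex_hull_subset_info[OF assms this] show "z \<in> info m ` designs_in X X'" by blast
qed

lemma info_designs:
  fixes X :: "'a::metric_space set" and m :: "'a \<Rightarrow> real^'n^'n"
  assumes "compact X" "continuous_on X m"
  shows "info m ` designs X = convex hull (m ` X)"
proof (intro equalityI subsetI)
  fix z assume "z \<in> info m ` designs X"
  then obtain \<xi> where \<xi>: "\<xi> \<in> designs X" "z = info m \<xi>" by auto
  then interpret prob_space \<xi> by (simp add: designs_def)
  show "z \<in> convex hull (m ` X)"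
    unfolding \<xi>(2) info_def using \<xi>(1) assms
    by (intro integral_in_closed_convex integrable_design[OF assms])
       (auto simp: space_design hull_inc
         intro!: compact_imp_closed compact_convex_hull compact_continuous_image AE_I2)
next
  fix z assume "z \<in> convex hull (m ` X)"
  then obtain S where S: "finite S" "S \<subseteq> m ` X" "z \<in> convex hull S"
    by (auto simp: convex_hull_explicit convex_hull_finite)
  then obtain X' where "finite X'" "X' \<subseteq> X" "S = m ` X'"
    by (metis finite_subset_image)
  then show "z \<in> info m ` designs X"
    using convex_hull_subset_info[OF assms, of X' z] S(3) by (auto simp: designs_in_def)
qed

section \<open>Directional derivatives of convex criteria\<close>

text \<open>The restriction of an extension to a short segment in \<open>S\<close> is the restriction of \<open>f\<close>, which
  therefore determines the derivative of the extension in the direction of the segment as a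
  one-sided limit.\<close>

lemma diff_extension_tendsto:
  fixes f :: "'v::real_normed_vector \<Rightarrow> real"
  assumes ext: "diff_extension S f U g" and "0 < t'" and seg: "\<And>t. t \<in> {0..t'} \<Longrightarrow> A + t *\<^sub>R E \<in> S"
  shows "((\<lambda>t. (f (A + t *\<^sub>R E) - f A) / t) \<longlongrightarrow> frechet_derivative g (at A) E) (at_right 0)"
proof -
  define D where "D = frechet_derivative g (at A)"
  have A: "A \<in> S" using seg[of 0] \<open>0 < t'\<close> by simp
  have D: "(g has_derivative D) (at A)"
    using ext A unfolding D_def diff_extension_def frechet_derivative_works[symmetric] by auto
  have "((\<lambda>t. A + t *\<^sub>R E) has_derivative (\<lambda>t. t *\<^sub>R E)) (at 0)"
    by (auto intro!: derivative_eq_intros)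
  then have "((\<lambda>t::real. g (A + t *\<^sub>R E)) has_derivative (\<lambda>t. D (t *\<^sub>R E))) (at 0)"
    by (rule has_derivative_compose) (use D in simp)
  moreover have "(\<lambda>t. D (t *\<^sub>R E)) = (*) (D E)"
    using linear_scale[OF has_derivative_linear[OF D]] by (simp add: fun_eq_iff)
  ultimately have "((\<lambda>t. g (A + t *\<^sub>R E)) has_field_derivative D E) (at 0)"
    by (simp add: has_field_derivative_def)
  then have "((\<lambda>t. (g (A + t *\<^sub>R E) - g A) / t) \<longlongrightarrow> D E) (at_right 0)"
    unfolding DERIV_def by (auto intro: filterlim_mono at_le)
  moreover have "\<forall>\<^sub>F t in at_right 0. (g (A + t *\<^sub>R E) - g A) / t = (f (A + t *\<^sub>R E) - f A) / t"
    unfolding eventually_at_right_field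
  proof (intro exI[of _ t'] conjI allI impI)
    fix t assume "0 < t" "t < t'"
    then have "A + t *\<^sub>R E \<in> S" using seg by simp
    then show "(g (A + t *\<^sub>R E) - g A) / t = (f (A + t *\<^sub>R E) - f A) / t"
      using ext A by (simp add: diff_extension_def)
  qed (rule \<open>0 < t'\<close>)
  ultimately show ?thesis
    unfolding D_def by (rule Lim_transform_eventually)
qed

lemma set_deriv_eq:
  fixes f :: "'v::real_normed_vector \<Rightarrow> real"
  assumes ext: "diff_extension S f U g" and seg: "0 < t'" "\<And>t. t \<in> {0..t'} \<Longrightarrow> A + t *\<^sub>R E \<in> S"
  shows "set_deriv S f A E = frechet_derivative g (at A) E"
  unfolding set_deriv_def
proof (rule the_equality)
  show "\<exists>V h. diff_extension S f V h \<and> frechet_derivative g (at A) E = frechet_derivative h (at A) E"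
    using ext by blast
next
  fix d assume "\<exists>V h. diff_extension S f V h \<and> d = frechet_derivative h (at A) E"
  then obtain V h where h: "diff_extension S f V h" "d = frechet_derivative h (at A) E" by blast
  then show "d = frechet_derivative g (at A) E"
    using tendsto_unique[OF trivial_limit_at_right_real diff_extension_tendsto[OF h(1) seg]
      diff_extension_tendsto[OF ext seg]] by simp
qed

lemma psd_convex: "convex (psd :: (real^'n^'n) set)"
  unfolding convex_def psd_def
proof (intro ballI allI impI CollectI conjI, goal_cases)
  case (1 A B u v)
  then show ?case by (simp add: transpose_def vec_eq_iff)
next
  case (2 A B u v w)
  have "w \<bullet> ((u *\<^sub>R A + v *\<^sub>R B) *v w) = u * (w \<bullet> (A *v w)) + v * (w \<bullet> (B *v w))"
    by (simp add: matrix_vector_mult_add_rdistrib scaleR_matrix_vector_assoc[symmetric] inner_add_right)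
  then show ?case using 2 by simp
qed

lemma eff_dom_ereal:
  assumes "criterion \<Psi>" "A \<in> eff_dom \<Psi>"
  shows "\<Psi> A = ereal (real_of_ereal (\<Psi> A))"
  using assms by (cases "\<Psi> A") (auto simp: criterion_def eff_dom_def)

lemma convex_combination_eff_dom:
  assumes "criterion \<Psi>" "criterion_convex \<Psi>" "A \<in> eff_dom \<Psi>" "B \<in> eff_dom \<Psi>" "t \<in> {0..1}"
  shows "(1 - t) *\<^sub>R A + t *\<^sub>R B \<in> eff_dom \<Psi>"
    and "real_of_ereal (\<Psi> ((1 - t) *\<^sub>R A + t *\<^sub>R B))
           \<le> (1 - t) * real_of_ereal (\<Psi> A) + t * real_of_ereal (\<Psi> B)"
proof -
  let ?C = "(1 - t) *\<^sub>R A + t *\<^sub>R B"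
  have psd: "A \<in> psd" "B \<in> psd" using assms(3,4) by (auto simp: eff_dom_def)
  have C: "?C \<in> psd"
    using convexD[OF psd_convex psd, of "1 - t" t] assms(5) by simp
  have "\<Psi> ?C \<le> ereal (1 - t) * \<Psi> A + ereal t * \<Psi> B"
    using assms(2,5) psd by (auto simp: criterion_convex_def)
  also have "\<dots> = ereal ((1 - t) * real_of_ereal (\<Psi> A) + t * real_of_ereal (\<Psi> B))"
    using eff_dom_ereal[OF assms(1,3)] eff_dom_ereal[OF assms(1,4)]
    by (metis plus_ereal.simps(1) times_ereal.simps(1))
  finally have le: "\<Psi> ?C \<le> ereal ((1 - t) * real_of_ereal (\<Psi> A) + t * real_of_ereal (\<Psi> B))" .
  then show *: "?C \<in> eff_dom \<Psi>"
    using C by (auto simp: eff_dom_def)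
  show "real_of_ereal (\<Psi> ?C) \<le> (1 - t) * real_of_ereal (\<Psi> A) + t * real_of_ereal (\<Psi> B)"
    using le eff_dom_ereal[OF assms(1) *] by (metis ereal_less_eq(3))
qed

text \<open>The tangent of a convex function lies below it: the difference quotients along the segment
  are at most the increment over the whole segment.\<close>

lemma derivative_le_increment:
  assumes "criterion \<Psi>" "criterion_convex \<Psi>" "A \<in> eff_dom \<Psi>" "B \<in> eff_dom \<Psi>"
    and ext: "diff_extension (eff_dom \<Psi>) (\<lambda>A. real_of_ereal (\<Psi> A)) U g"
  shows "frechet_derivative g (at A) (B - A) \<le> real_of_ereal (\<Psi> B) - real_of_ereal (\<Psi> A)"
proof -
  have eq: "A + t *\<^sub>R (B - A) = (1 - t) *\<^sub>R A + t *\<^sub>R B" for t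
    by (simp add: algebra_simps)
  let ?q = "\<lambda>t. (real_of_ereal (\<Psi> (A + t *\<^sub>R (B - A))) - real_of_ereal (\<Psi> A)) / t"
  have "(?q \<longlongrightarrow> frechet_derivative g (at A) (B - A)) (at_right 0)"
    by (rule diff_extension_tendsto[OF ext zero_less_one])
       (unfold eq, rule convex_combination_eff_dom(1)[OF assms(1-4)])
  moreover have "\<forall>\<^sub>F t in at_right 0. ?q t \<le> real_of_ereal (\<Psi> B) - real_of_ereal (\<Psi> A)"
    unfolding eventually_at_right_field
  proof (intro exI[of _ 1] conjI allI impI)
    fix t :: real assume t: "0 < t" "t < 1"
    then have "real_of_ereal (\<Psi> (A + t *\<^sub>R (B - A))) - real_of_ereal (\<Psi> A)
      \<le> t * (real_of_ereal (\<Psi> B) - real_of_ereal (\<Psi> A))"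
      using convex_combination_eff_dom(2)[OF assms(1-4), of t] by (simp add: eq algebra_simps)
    then show "?q t \<le> real_of_ereal (\<Psi> B) - real_of_ereal (\<Psi> A)"
      using t by (simp add: divide_le_eq mult.commute)
  qed simp
  ultimately show ?thesis
    by (rule tendsto_upperbound) simp
qed

section \<open>Existence of an optimal design\<close>

text \<open>A minimizing sequence has a limit point in \<open>C\<close>, and by lower semicontinuity the value there does
  not exceed the limit of the values.\<close>

lemma lsc_attains_inf:
  fixes f :: "'a::metric_space \<Rightarrow> ereal"
  assumes C: "compact C" "C \<noteq> {}" "C \<subseteq> S" and lsc: "\<And>y. y \<in> S \<Longrightarrow> f y \<le> Liminf (at y within S) f"
  shows "\<exists>y\<in>C. f y = (INF z\<in>C. f z)"
proof -
  define I where "I = (INF z\<in>C. f z)"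
  obtain v where v: "\<And>n::nat. v n \<in> f ` C" "v \<longlonglongrightarrow> I"
    using Inf_as_limit[of "f ` C"] C(2) unfolding I_def by auto
  then have "\<forall>n. \<exists>w. w \<in> C \<and> v n = f w" by blast
  then obtain w where w: "\<And>n. w n \<in> C" "\<And>n. v n = f (w n)" by metis
  obtain y r where y: "y \<in> C" "strict_mono r" "(w \<circ> r) \<longlonglongrightarrow> y"
    using C(1) w(1) unfolding compact_def by metis
  have lim: "(\<lambda>n. f (w (r n))) \<longlonglongrightarrow> I"
    using LIMSEQ_subseq_LIMSEQ[OF v(2) y(2)] w(2) by (simp add: o_def)
  have "f y \<le> I"
  proof (rule ccontr)
    assume "\<not> f y \<le> I"
    then obtain c where c: "I < c" "c < f y" using dense[of I "f y"] by (auto simp: not_le)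
    have "\<forall>\<^sub>F z in at y within S. c < f z"
      using less_LiminfD[OF less_le_trans[OF c(2) lsc]] y(1) C(3) by blast
    \<comment> \<open>The limit inferior omits \<open>y\<close> itself, where the inequality is the choice of \<open>c\<close>.\<close>
    then obtain d where d: "d > 0" "\<And>z. z \<in> S \<Longrightarrow> dist z y < d \<Longrightarrow> c < f z"
      using c(2) unfolding eventually_at by (metis)
    have "\<forall>\<^sub>F n in sequentially. dist (w (r n)) y < d"
      using y(3) d(1) by (auto simp: o_def dest: tendstoD)
    moreover have "\<forall>\<^sub>F n in sequentially. f (w (r n)) < c"
      using order_tendstoD(2)[OF lim c(1)] .
    ultimately have "\<forall>\<^sub>F n in sequentially. False"
      by eventually_elim (use d(2) w(1) C(3) in \<open>meson less_asym subsetD\<close>)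
    then show False by simp
  qed
  moreover have "I \<le> f y" unfolding I_def using y(1) by (rule INF_lower)
  ultimately show ?thesis using y(1) unfolding I_def by (metis antisym)
qed

lemma optimal_design_exists:
  fixes X :: "'a::metric_space set" and m :: "'a \<Rightarrow> real^'n^'n"
  assumes "compact X" "continuous_on X m" "m ` X \<subseteq> psd" "criterion_lsc \<Psi>" "X \<noteq> {}"
  shows "\<exists>\<eta>\<in>designs X. \<Psi> (info m \<eta>) = opt_value \<Psi> m X"
proof -
  have "\<exists>z\<in>info m ` designs X. \<Psi> z = (INF z\<in>info m ` designs X. \<Psi> z)"
    unfolding info_designs[OF assms(1,2)]
  proof (rule lsc_attains_inf)
    show "compact (convex hull (m ` X))"
      using assms by (intro compact_convex_hull compact_continuous_image)
    show "convex hull (m ` X) \<subseteq> psd"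
      using assms(3) psd_convex by (rule hull_minimal)
  qed (use assms in \<open>auto simp: criterion_lsc_def\<close>)
  then show ?thesis by (auto simp: opt_value_def image_image)
qed

section \<open>The rate of convergence\<close>

text \<open>Multiplied by \<open>(k + 1) (k + 2)\<close>, the recursion telescopes in the quantity
  \<open>k (k + 1) r k\<close>, which grows by at most \<open>2 c\<close> in each step.\<close>

lemma recursion_rate:
  fixes r :: "nat \<Rightarrow> real"
  assumes "0 \<le> c" "0 \<le> r 1" "2 \<le> n"
    and step: "\<And>k. 1 \<le> k \<Longrightarrow> k < n \<Longrightarrow>
      r (Suc k) \<le> (1 - 2 / (real k + 2)) * r k + 2 * c / (real k + 2)\<^sup>2"
  shows "r n \<le> 2 / (real n + 2) * (r 1 + c)"
proof -
  have "real k * (real k + 1) * r k \<le> 2 * r 1 + (real k - 1) * (2 * c)" if "1 \<le> k" "k \<le> n" for k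
    using that
  proof (induction k rule: dec_induct)
    case (step k)
    let ?a = "real k + 1" and ?b = "real k + 2"
    have "?a * ?b * r (Suc k) \<le> ?a * ?b * ((1 - 2 / ?b) * r k + 2 * c / ?b\<^sup>2)"
      using assms(4)[of k] step by (intro mult_left_mono) auto
    also have "\<dots> = real k * ?a * r k + (?a / ?b) * (2 * c)"
    proof -
      have "a * b * ((1 - 2 / b) * q + 2 * c / b\<^sup>2) = (b - 2) * a * q + (a / b) * (2 * c)"
        if "b \<noteq> 0" for a b q :: real
        using that by (simp add: field_simps power2_eq_square)
      from this[of ?b ?a "r k"] show ?thesis by simp
    qed
    also have "\<dots> \<le> real k * ?a * r k + 1 * (2 * c)"
      using assms(1) by (intro add_left_mono mult_right_mono) auto
    also have "\<dots> \<le> 2 * r 1 + real k * (2 * c)"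
      using step by (simp add: algebra_simps)
    finally show ?case by (simp add: algebra_simps)
  qed simp
  then have "real n * (real n + 1) * r n \<le> 2 * r 1 + (real n - 1) * (2 * c)"
    using assms(3) by simp
  then have "(real n + 2) * (real n * (real n + 1) * r n)
      \<le> (real n + 2) * (2 * r 1 + (real n - 1) * (2 * c))"
    by (intro mult_left_mono) auto
  also have "\<dots> = (real n + 2) * (2 * r 1) + ((real n + 2) * (real n - 1)) * (2 * c)"
    by (simp add: algebra_simps)
  also have "\<dots> \<le> (real n * (real n + 1)) * (2 * r 1) + (real n * (real n + 1)) * (2 * c)"
  proof (intro add_mono mult_right_mono)
    have "2 * 2 \<le> real n * real n" using assms(3) by (intro mult_mono) auto
    then show "real n + 2 \<le> real n * (real n + 1)" by (simp add: algebra_simps)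
    show "(real n + 2) * (real n - 1) \<le> real n * (real n + 1)" by (simp add: algebra_simps)
  qed (use assms in auto)
  finally have "(real n * (real n + 1)) * ((real n + 2) * r n)
      \<le> (real n * (real n + 1)) * (2 * (r 1 + c))"
    by (simp add: algebra_simps)
  then have "(real n + 2) * r n \<le> 2 * (r 1 + c)"
    using assms(3) by (subst (asm) mult_le_cancel_left_pos) auto
  then show ?thesis by (simp add: field_simps)
qed

text \<open>By convexity the derivative at \<open>A\<close> towards \<open>B\<close> is at most the increment of the criterion. Since
  \<open>B\<close> is a convex combination of the matrices \<open>m y\<close> and the derivative is linear, the derivative towards
  some \<open>m y\<close>, which is the sensitivity at \<open>y\<close>, is at most as large. For an optimal \<open>B\<close> this bounds
  the sensitivity by minus the optimality gap.\<close>

lemma sensitivity_approx_solution: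
  fixes X :: "'a::metric_space set" and m :: "'a \<Rightarrow> real^'n^'n"
  assumes "compact X" "continuous_on X m" "criterion \<Psi>" "criterion_convex \<Psi>"
    and diff: "set_differentiable (eff_dom \<Psi>) (\<lambda>A. real_of_ereal (\<Psi> A))"
    and dir: "directionally_open (eff_dom \<Psi>) (info m ` designs X)"
    and A: "A \<in> eff_dom \<Psi>" and B: "B \<in> eff_dom \<Psi>" "B \<in> info m ` designs X"
    and sol: "approx_solution \<delta> X (\<lambda>y. ereal (sensitivity \<Psi> m A y)) z"
  shows "sensitivity \<Psi> m A z \<le> real_of_ereal (\<Psi> B) - real_of_ereal (\<Psi> A) + \<delta>"
proof -
  obtain U g where ext: "diff_extension (eff_dom \<Psi>) (\<lambda>A. real_of_ereal (\<Psi> A)) U g"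
    using diff by (auto simp: set_differentiable_def)
  define D where "D = frechet_derivative g (at A)"
  have "g differentiable (at A)" using ext A by (auto simp: diff_extension_def)
  then have lin: "linear D" unfolding D_def by (rule linear_frechet_derivative)
  have sens: "sensitivity \<Psi> m A y = D (m y - A)" if "y \<in> X" for y
  proof -
    have "m y \<in> info m ` designs X"
      unfolding info_designs[OF assms(1,2)] using that by (simp add: hull_inc)
    then obtain t' where "0 < t'" "\<And>t. t \<in> {0..t'} \<Longrightarrow> A + t *\<^sub>R (m y - A) \<in> eff_dom \<Psi>"
      using dir A unfolding directionally_open_def by metis
    then show ?thesis
      unfolding sensitivity_def D_def by (rule set_deriv_eq[OF ext])
  qed
  have le: "sensitivity \<Psi> m A z - \<delta> \<le> D (m y) - D A" if "y \<in> X" for y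
  proof -
    have "ereal (sensitivity \<Psi> m A z) \<le> (INF y\<in>X. ereal (sensitivity \<Psi> m A y)) + ereal \<delta>"
      using sol by (simp add: approx_solution_def)
    also have "\<dots> \<le> ereal (sensitivity \<Psi> m A y) + ereal \<delta>"
      using that by (intro add_right_mono INF_lower)
    finally show ?thesis using sens[OF that] lin by (simp add: linear_diff)
  qed
  have "convex (D -` {sensitivity \<Psi> m A z - \<delta> + D A..})"
    using lin by (intro convex_linear_vimage) auto
  then have "convex hull (m ` X) \<subseteq> D -` {sensitivity \<Psi> m A z - \<delta> + D A..}"
    using le by (intro hull_minimal) (auto simp: algebra_simps)
  then have "sensitivity \<Psi> m A z - \<delta> \<le> D (B - A)"
    using B(2) lin unfolding info_designs[OF assms(1,2)] by (auto simp: linear_diff)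
  also have "\<dots> \<le> real_of_ereal (\<Psi> B) - real_of_ereal (\<Psi> A)"
    unfolding D_def using derivative_le_increment[OF assms(3,4) A B(1) ext] .
  finally show ?thesis by simp
qed

text \<open>On the segment both the derivative relative to \<open>C\<close> and the one relative to the domain are
  derivatives of the same extension.\<close>

lemma smooth_step:
  assumes diff: "set_differentiable (eff_dom \<Psi>) (\<lambda>A. real_of_ereal (\<Psi> A))"
    and smooth: "L_smooth L C (\<lambda>A. real_of_ereal (\<Psi> A))" and C: "C \<subseteq> eff_dom \<Psi>"
    and seg: "\<And>t. t \<in> {0..a} \<Longrightarrow> (1 - t) *\<^sub>R A + t *\<^sub>R m z \<in> C" and t: "0 < t" "t \<le> a"
  shows "real_of_ereal (\<Psi> ((1 - t) *\<^sub>R A + t *\<^sub>R m z))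
    \<le> real_of_ereal (\<Psi> A) + t * sensitivity \<Psi> m A z + L / 2 * t\<^sup>2 * (norm (m z - A))\<^sup>2"
proof -
  let ?f = "\<lambda>A. real_of_ereal (\<Psi> A)"
  let ?B = "(1 - t) *\<^sub>R A + t *\<^sub>R m z"
  obtain U g where ext: "diff_extension (eff_dom \<Psi>) ?f U g"
    using diff by (auto simp: set_differentiable_def)
  then have ext': "diff_extension C ?f U g" using C by (auto simp: diff_extension_def)
  define D where "D = frechet_derivative g (at A)"
  have segC: "A + s *\<^sub>R (m z - A) \<in> C" if "s \<in> {0..a}" for s
    using seg[OF that] by (simp add: algebra_simps)
  have AC: "A \<in> C" using segC[of 0] t by simp
  have "g differentiable (at A)" using ext' AC by (auto simp: diff_extension_def)
  then have lin: "linear D" unfolding D_def by (rule linear_frechet_derivative)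
  have B: "?B - A = t *\<^sub>R (m z - A)" by (simp add: algebra_simps)
  have sens: "sensitivity \<Psi> m A z = D (m z - A)"
    unfolding sensitivity_def D_def
    by (rule set_deriv_eq[OF ext, of a]) (use t segC C in auto)
  have "set_deriv C ?f A (?B - A) = D (?B - A)"
    unfolding D_def
  proof (rule set_deriv_eq[OF ext' zero_less_one])
    fix s :: real assume "s \<in> {0..1}"
    then have "0 \<le> s * t" "s * t \<le> 1 * t" using t by (auto intro!: mult_right_mono)
    then have "s * t \<in> {0..a}" using t(2) unfolding atLeastAtMost_iff by linarith
    from segC[OF this] show "A + s *\<^sub>R (?B - A) \<in> C" unfolding B by simp
  qed
  also have "\<dots> = t * D (m z - A)"
    unfolding B using linear_scale[OF lin] by simp
  finally have sd: "set_deriv C ?f A (?B - A) = t * sensitivity \<Psi> m A z"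
    using sens by simp
  have "?f ?B - ?f A - set_deriv C ?f A (?B - A) \<le> L / 2 * (norm (?B - A))\<^sup>2"
    using smooth AC seg[of t] t by (auto simp: L_smooth_def)
  moreover have "(norm (?B - A))\<^sup>2 = t\<^sup>2 * (norm (m z - A))\<^sup>2"
    unfolding B by (simp add: power_mult_distrib)
  ultimately show ?thesis unfolding sd by simp
qed

text \<open>Both variants of the algorithm keep the support of the current design and no points outside
  the current discretization. So the next discretization carries every mixture of the current
  design with the point mass at the new point, and the next value is at most that of the
  mixture, up to the tolerance.\<close>

lemma strict_algorithm_properties:
  fixes X :: "'a::metric_space set" and m :: "'a \<Rightarrow> real^'n^'n"
  assumes "compact X" "continuous_on X m" "finite X0" "X0 \<subseteq> X"
    and alg: "strict_algorithm keep \<Psi> m X X0 \<epsilon> \<delta>o \<delta>u Xs \<xi> x"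
    and keep: "\<And>X' \<xi>'. supp \<xi>' \<subseteq> X' \<Longrightarrow> supp \<xi>' \<subseteq> keep X' \<xi>' \<and> keep X' \<xi>' \<subseteq> X'"
    and k: "k \<in> iterations \<Psi> m \<epsilon> \<delta>u \<xi> x"
  shows "\<xi> k \<in> designs X"
    and "approx_solution (\<delta>u k) X (\<lambda>y. ereal (sensitivity \<Psi> m (info m (\<xi> k)) y)) (x k)"
    and "\<And>t. Suc k \<in> iterations \<Psi> m \<epsilon> \<delta>u \<xi> x \<Longrightarrow> t \<in> {0..1} \<Longrightarrow>
      \<Psi> (info m (\<xi> (Suc k)))
        \<le> \<Psi> ((1 - t) *\<^sub>R info m (\<xi> k) + t *\<^sub>R m (x k)) + ereal (\<delta>o (Suc k))"
proof -
  let ?K = "iterations \<Psi> m \<epsilon> \<delta>u \<xi> x"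
  have sol: "approx_solution (\<delta>o j) (designs_in X (Xs j)) (\<lambda>\<eta>. \<Psi> (info m \<eta>)) (\<xi> j)"
    and sol': "approx_solution (\<delta>u j) X (\<lambda>y. ereal (sensitivity \<Psi> m (info m (\<xi> j)) y)) (x j)"
    and ex: "sensitivity \<Psi> m (info m (\<xi> j)) (x j) < - \<epsilon> + \<delta>u j
      \<Longrightarrow> Xs (Suc j) = keep (Xs j) (\<xi> j) \<union> {x j}" if "j \<in> ?K" for j
    using alg[unfolded strict_algorithm_def, THEN conjunct2, THEN bspec, OF that] by blast+
  have \<xi>: "\<xi> j \<in> designs X" "supp (\<xi> j) \<subseteq> Xs j" if "j \<in> ?K" for j
    using sol[OF that] by (auto simp: approx_solution_def designs_in_def)
  have xX: "x j \<in> X" if "j \<in> ?K" for j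
    using sol'[OF that] by (simp add: approx_solution_def)
  have suc: "j \<in> ?K" "Xs (Suc j) = keep (Xs j) (\<xi> j) \<union> {x j}" if "Suc j \<in> ?K" for j
  proof -
    show "j \<in> ?K" using that by (auto simp: iterations_def)
    then show "Xs (Suc j) = keep (Xs j) (\<xi> j) \<union> {x j}"
      by (rule ex) (use that in \<open>auto simp: iterations_def\<close>)
  qed
  have Xs: "finite (Xs j) \<and> Xs j \<subseteq> X" if "j \<in> ?K" for j
    using that
  proof (induction j)
    case 0
    then show ?case using alg assms(3,4) by (simp add: strict_algorithm_def)
  next
    case (Suc j)
    note j = suc[OF Suc.prems]
    show ?case
      using Suc.IH[OF j(1)] keep[OF \<xi>(2)[OF j(1)]] xX[OF j(1)]
      unfolding j(2) by (auto intro: finite_subset)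
  qed
  show "\<xi> k \<in> designs X" by (rule \<xi>(1)[OF k])
  show "approx_solution (\<delta>u k) X (\<lambda>y. ereal (sensitivity \<Psi> m (info m (\<xi> k)) y)) (x k)"
    by (rule sol'[OF k])
  fix t :: real assume S: "Suc k \<in> ?K" and t: "t \<in> {0..1}"
  have kp: "supp (\<xi> k) \<subseteq> Xs (Suc k)"
    using keep[OF \<xi>(2)[OF k]] suc(2)[OF S] by auto
  then have "info m (\<xi> k) \<in> convex hull (m ` Xs (Suc k))"
    using info_designs_in[OF assms(1,2)] Xs[OF S] \<xi>(1)[OF k] unfolding designs_in_def by blast
  moreover have "m (x k) \<in> convex hull (m ` Xs (Suc k))"
    using suc(2)[OF S] by (simp add: hull_inc)
  ultimately have "(1 - t) *\<^sub>R info m (\<xi> k) + t *\<^sub>R m (x k) \<in> convex hull (m ` Xs (Suc k))"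
    using t by (intro convexD[OF convex_convex_hull]) auto
  then obtain \<eta> where \<eta>: "\<eta> \<in> designs_in X (Xs (Suc k))"
      "info m \<eta> = (1 - t) *\<^sub>R info m (\<xi> k) + t *\<^sub>R m (x k)"
    using convex_hull_subset_info[OF assms(1,2)] Xs[OF S] by blast
  have "\<Psi> (info m (\<xi> (Suc k)))
      \<le> (INF \<eta>\<in>designs_in X (Xs (Suc k)). \<Psi> (info m \<eta>)) + ereal (\<delta>o (Suc k))"
    using sol[OF S] by (simp add: approx_solution_def)
  also have "\<dots> \<le> \<Psi> (info m \<eta>) + ereal (\<delta>o (Suc k))"
    using \<eta>(1) by (intro add_right_mono INF_lower)
  finally show "\<Psi> (info m (\<xi> (Suc k)))
      \<le> \<Psi> ((1 - t) *\<^sub>R info m (\<xi> k) + t *\<^sub>R m (x k)) + ereal (\<delta>o (Suc k))"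
    unfolding \<eta>(2) .
qed

theorem theorem3p16:
  fixes X :: "'a::metric_space set"
    and m :: "'a \<Rightarrow> real^'n^'n"
    and \<Psi> :: "real^'n^'n \<Rightarrow> ereal"
    and X0 :: "'a set"
    and \<epsilon> :: real and \<delta>o \<delta>u :: "nat \<Rightarrow> real"
    and co cu L :: real
    and Xs :: "nat \<Rightarrow> 'a set" and \<xi> :: "nat \<Rightarrow> 'a measure" and x :: "nat \<Rightarrow> 'a"
    and K :: "nat set" and MM :: "(real^'n^'n) set"
  assumes "compact X"
    and "continuous_on X m" and "m ` X \<subseteq> psd"
    and "criterion \<Psi>" and "criterion_convex \<Psi>" and "criterion_lsc \<Psi>"
    and "finite_designs \<Psi> m (designs X) \<noteq> {}"
    and "set_continuously_differentiable (eff_dom \<Psi>) (\<lambda>A. real_of_ereal (\<Psi> A))"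
    and "directionally_open (eff_dom \<Psi>) (info m ` designs X)"
    and "finite X0" and "X0 \<subseteq> X"
    and "finite_designs \<Psi> m (designs_in X X0) \<noteq> {}"
    and "0 \<le> \<epsilon>" and "\<And>k. 0 \<le> \<delta>o k" and "\<And>k. 0 \<le> \<delta>u k"
    and "strict_algorithm_without_exchange \<Psi> m X X0 \<epsilon> \<delta>o \<delta>u Xs \<xi> x \<or>
         strict_algorithm_with_exchange \<Psi> m X X0 \<epsilon> \<delta>o \<delta>u Xs \<xi> x"
    and "K = iterations \<Psi> m \<epsilon> \<delta>u \<xi> x"
    and "0 \<le> co" and "0 \<le> cu"
    and "\<And>k. \<delta>o k \<le> co / (real k + 1)\<^sup>2"
    and "\<And>k. \<delta>u k \<le> cu / (real k + 2)"
    and "MM = convex hull {(1 - \<alpha>) *\<^sub>R info m (\<xi> k) + \<alpha> *\<^sub>R m (x k) | k \<alpha>. k \<in> K \<and> \<alpha> \<in> {0..2/3}}"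
    and "MM \<subseteq> eff_dom \<Psi>"
    and "0 \<le> L" and "L_smooth L MM (\<lambda>A. real_of_ereal (\<Psi> A))"
  shows "(\<exists>\<eta>\<in>designs X. \<Psi> (info m \<eta>) = opt_value \<Psi> m X) \<and>
         (\<forall>k\<in>K. 2 \<le> k \<longrightarrow>
            \<Psi> (info m (\<xi> k)) - opt_value \<Psi> m X
              \<le> ereal (2 / (real k + 2)) *
                  ((\<Psi> (info m (\<xi> 1)) - opt_value \<Psi> m X)
                    + ereal (L * (diameter (info m ` designs X))\<^sup>2 + co + cu)))"
proof -
  let ?f = "\<lambda>A. real_of_ereal (\<Psi> A)"
  let ?M = "\<lambda>k. info m (\<xi> k)"
  note cpt = \<open>compact X\<close> and cont = \<open>continuous_on X m\<close> and crit = \<open>criterion \<Psi>\<close>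
  obtain \<xi>' where \<xi>': "\<xi>' \<in> designs X"
    using \<open>finite_designs \<Psi> m (designs X) \<noteq> {}\<close> by (auto simp: finite_designs_def)
  then have "prob_space \<xi>'" by (simp add: designs_def)
  then have "X \<noteq> {}"
    using space_design[OF \<xi>'] prob_space.not_empty by blast
  then obtain \<eta> where \<eta>: "\<eta> \<in> designs X" "\<Psi> (info m \<eta>) = opt_value \<Psi> m X"
    using optimal_design_exists[OF cpt cont \<open>m ` X \<subseteq> psd\<close> \<open>criterion_lsc \<Psi>\<close>] by blast
  \<comment> \<open>The two variants are treated together through these properties of the kept points.\<close>
  have "\<exists>keep. strict_algorithm keep \<Psi> m X X0 \<epsilon> \<delta>o \<delta>u Xs \<xi> x \<and>
    (\<forall>X' \<xi>'. supp \<xi>' \<subseteq> X' \<longrightarrow> supp \<xi>' \<subseteq> keep X' \<xi>' \<and> keep X' \<xi>' \<subseteq> X')"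
    using \<open>strict_algorithm_without_exchange \<Psi> m X X0 \<epsilon> \<delta>o \<delta>u Xs \<xi> x \<or> _\<close>
  proof
    assume "strict_algorithm_without_exchange \<Psi> m X X0 \<epsilon> \<delta>o \<delta>u Xs \<xi> x"
    then show ?thesis by (intro exI[of _ "\<lambda>X' \<xi>'. X'"]) simp
  next
    assume "strict_algorithm_with_exchange \<Psi> m X X0 \<epsilon> \<delta>o \<delta>u Xs \<xi> x"
    then show ?thesis by (intro exI[of _ "\<lambda>X' \<xi>'. supp \<xi>'"]) simp
  qed
  then obtain keep where alg: "strict_algorithm keep \<Psi> m X X0 \<epsilon> \<delta>o \<delta>u Xs \<xi> x"
    and keep: "\<And>X' \<xi>'. supp \<xi>' \<subseteq> X' \<Longrightarrow> supp \<xi>' \<subseteq> keep X' \<xi>' \<and> keep X' \<xi>' \<subseteq> X'"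
    by auto
  note props = strict_algorithm_properties[OF cpt cont \<open>finite X0\<close> \<open>X0 \<subseteq> X\<close> alg keep,
      folded \<open>K = _\<close>]
  have diff: "set_differentiable (eff_dom \<Psi>) ?f"
    using \<open>set_continuously_differentiable _ _\<close>
    by (auto simp: set_continuously_differentiable_def set_differentiable_def)
  have seg: "(1 - t) *\<^sub>R ?M k + t *\<^sub>R m (x k) \<in> MM" if "k \<in> K" "t \<in> {0..2/3}" for k t
    unfolding \<open>MM = _\<close> using that by (intro hull_inc) blast
  have dom: "?M k \<in> eff_dom \<Psi>" if "k \<in> K" for k
    using seg[OF that, of 0] \<open>MM \<subseteq> eff_dom \<Psi>\<close> by auto
  have opt_le: "opt_value \<Psi> m X \<le> \<Psi> (?M k)" if "k \<in> K" for k
    unfolding opt_value_def using props(1)[OF _ that] by (intro INF_lower) auto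
  define d where "d = diameter (info m ` designs X)"
  have bdd: "bounded (info m ` designs X)"
    unfolding info_designs[OF cpt cont]
    using cpt cont by (intro compact_imp_bounded compact_convex_hull compact_continuous_image)
  show ?thesis
  proof (intro conjI ballI impI)
    show "\<exists>\<eta>\<in>designs X. \<Psi> (info m \<eta>) = opt_value \<Psi> m X" using \<eta> by blast
  next
    fix n assume n: "n \<in> K" "2 \<le> n"
    have K: "k \<in> K" if "k \<le> n" for k
      using n(1) that unfolding \<open>K = _\<close> iterations_def by auto
    have "info m \<eta> \<in> convex hull (m ` X)" using \<eta>(1) info_designs[OF cpt cont] by blast
    then have "info m \<eta> \<in> psd"
      using hull_minimal[of "m ` X" psd convex] \<open>m ` X \<subseteq> psd\<close> psd_convex by blast
    moreover have "\<Psi> (info m \<eta>) < \<infinity>"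
      using opt_le[OF n(1)] dom[OF n(1)] \<eta>(2) by (auto simp: eff_dom_def)
    ultimately have B: "info m \<eta> \<in> eff_dom \<Psi>" by (simp add: eff_dom_def)
    define o' where "o' = ?f (info m \<eta>)"
    have o': "opt_value \<Psi> m X = ereal o'"
      using eff_dom_ereal[OF crit B] \<eta>(2) by (simp add: o'_def)
    have \<Psi>: "\<Psi> (?M k) = ereal (?f (?M k))" if "k \<le> n" for k
      by (rule eff_dom_ereal[OF crit dom[OF K[OF that]]])
    define r where "r k = ?f (?M k) - o'" for k
    define c where "c = L * d\<^sup>2 + co + cu"
    have "0 \<le> c" using assms by (simp add: c_def)
    have "0 \<le> r 1"
      using opt_le[OF K] \<Psi>[of 1] n(2) o' unfolding r_def
      by (metis One_nat_def Suc_leD diff_ge_0_iff_ge ereal_less_eq(3) numeral_2_eq_2)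
    have "r n \<le> 2 / (real n + 2) * (r 1 + c)"
    proof (rule recursion_rate[where r = r, OF \<open>0 \<le> c\<close> \<open>0 \<le> r 1\<close> n(2)])
      fix k assume k: "1 \<le> k" "k < n"
      have kK: "k \<in> K" "Suc k \<in> K" using K[of k] K[of "Suc k"] k by simp_all
      \<comment> \<open>For \<open>k \<ge> 1\<close> this step size is at most \<open>2/3\<close>, so the mixture stays in \<open>MM\<close>.\<close>
      define t where "t = 2 / (real k + 2)"
      have t: "0 < t" "t \<le> 2/3" using k(1) by (auto simp: t_def field_simps)
      let ?B = "(1 - t) *\<^sub>R ?M k + t *\<^sub>R m (x k)"
      have BB: "?B \<in> eff_dom \<Psi>" using seg[OF kK(1), of t] t \<open>MM \<subseteq> _\<close> by auto
      have sens: "sensitivity \<Psi> m (?M k) (x k) \<le> - r k + \<delta>u k"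
        using sensitivity_approx_solution[OF cpt cont crit \<open>criterion_convex \<Psi>\<close> diff
            \<open>directionally_open _ _\<close> dom[OF kK(1)] B _ props(2)[OF _ kK(1)]] \<eta>(1)
        by (simp add: r_def o'_def)
      have "x k \<in> X" using props(2)[OF _ kK(1)] by (simp add: approx_solution_def)
      then have "m (x k) \<in> info m ` designs X"
        unfolding info_designs[OF cpt cont] by (simp add: hull_inc)
      then have "norm (m (x k) - ?M k) \<le> d"
        using diameter_bounded_bound[OF bdd, of "m (x k)" "?M k"] props(1)[OF _ kK(1)]
        by (simp add: d_def dist_norm)
      then have nd: "(norm (m (x k) - ?M k))\<^sup>2 \<le> d\<^sup>2" by (intro power_mono) auto
      have "ereal (?f (?M (Suc k))) \<le> ereal (?f ?B) + ereal (\<delta>o (Suc k))"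
        unfolding \<Psi>[of "Suc k", symmetric, OF Suc_leI[OF k(2)]] eff_dom_ereal[OF crit BB, symmetric]
        using props(3)[OF _ kK(1) kK(2), of t] t by auto
      then have "?f (?M (Suc k)) \<le> ?f ?B + \<delta>o (Suc k)" by simp
      also have "?f ?B \<le> ?f (?M k) + t * sensitivity \<Psi> m (?M k) (x k)
          + L / 2 * t\<^sup>2 * (norm (m (x k) - ?M k))\<^sup>2"
        by (rule smooth_step[where m = m and z = "x k" and A = "?M k" and t = t, OF diff \<open>L_smooth _ _ _\<close> \<open>MM \<subseteq> _\<close> seg[OF kK(1)] t])
      also have "\<dots> \<le> ?f (?M k) + t * (- r k + \<delta>u k) + L / 2 * t\<^sup>2 * d\<^sup>2"
        using sens nd t \<open>0 \<le> L\<close> by (intro add_mono mult_left_mono) auto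
      finally have "r (Suc k) \<le> (1 - t) * r k + t * \<delta>u k + L / 2 * t\<^sup>2 * d\<^sup>2 + \<delta>o (Suc k)"
        by (simp add: r_def algebra_simps)
      also have "\<dots> \<le> (1 - t) * r k + t * (cu / (real k + 2)) + L / 2 * t\<^sup>2 * d\<^sup>2
          + 2 * co / (real k + 2)\<^sup>2"
      proof -
        have "\<delta>u k \<le> cu / (real k + 2)" by fact
        then have u: "t * \<delta>u k \<le> t * (cu / (real k + 2))"
          by (rule mult_left_mono[OF _ less_imp_le[OF t(1)]])
        have "real (Suc k) + 1 = real k + 2" by simp
        then have "\<delta>o (Suc k) \<le> co / (real k + 2)\<^sup>2"
          using \<open>\<And>k. \<delta>o k \<le> co / (real k + 1)\<^sup>2\<close>[of "Suc k"] by metis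
        \<comment> \<open>The factor 2 gives all error terms the common form \<open>2 c / (k + 2)\<^sup>2\<close>.\<close>
        also have "\<dots> \<le> 2 * co / (real k + 2)\<^sup>2"
          using \<open>0 \<le> co\<close> by (intro divide_right_mono) auto
        finally show ?thesis using u by linarith
      qed
      also have "\<dots> = (1 - 2 / (real k + 2)) * r k + 2 * c / (real k + 2)\<^sup>2"
      proof -
        have "(1 - 2 / b) * q + 2 / b * (cu / b) + L / 2 * (2 / b)\<^sup>2 * d\<^sup>2 + 2 * co / b\<^sup>2
            = (1 - 2 / b) * q + 2 * c / b\<^sup>2" if "b \<noteq> 0" for b q
          using that unfolding c_def by (simp add: field_simps power2_eq_square)
        from this[of "real k + 2" "r k"] show ?thesis unfolding t_def by simp
      qed
      finally show "r (Suc k) \<le> (1 - 2 / (real k + 2)) * r k + 2 * c / (real k + 2)\<^sup>2" .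
    qed
    moreover have "\<Psi> (?M k) - opt_value \<Psi> m X = ereal (r k)" if "k \<le> n" for k
      by (subst \<Psi>[OF that]) (simp add: o' r_def)
    from this[of n] this[of 1] have "\<Psi> (?M n) - opt_value \<Psi> m X = ereal (r n)"
        "\<Psi> (?M 1) - opt_value \<Psi> m X = ereal (r 1)"
      using n(2) by simp_all
    ultimately show "\<Psi> (?M n) - opt_value \<Psi> m X \<le> ereal (2 / (real n + 2)) *
        ((\<Psi> (?M 1) - opt_value \<Psi> m X)
          + ereal (L * (diameter (info m ` designs X))\<^sup>2 + co + cu))"
      by (simp add: c_def d_def)
  qed
qed

end
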